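(* The kissing numbers in $\mathbb{R}^{17}$, $\mathbb{R}^{18}$, $\mathbb{R}^{19}$, $\mathbb{R}^{20}$, and $\mathbb{R}^{21}$ are at least $5730$, $7654$, $11692$, $19448$, and $29768$, respectively.
   Context: The kissing number in $\mathbb{R}^n$ is the largest number of unit spheres that can be arranged tangent to a central unit sphere so that their interiors are disjoint. Equivalently, it is the largest size of a subset $\mathcal{C}$ of the unit sphere $S^{n-1} \subseteq \mathbb{R}^n$ such that $\langle x,y\rangle \le 1/2$ for all $x,y \in \mathcal{C}$ with $x \ne y$, where $\langle\cdot,\cdot\rangle$ is the usual inner product on $\mathbb{R}^n$. *)

theory Defs
  imports "HOL-Analysis.Analysis"
begin

definition kissing_code :: "'a::euclidean_space set \<Rightarrow> bool" where
  "kissing_code C \<longleftrightarrow> C \<subseteq> sphere 0 1 \<and> (\<forall>x\<in>C. \<forall>y\<in>C. x \<noteq> y \<longrightarrow> x \<bullet> y \<le> 1/2)"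

text \<open>
  The dimension is carried by the type: the kissing number in \<open>\<real>\<^sup>n\<close> is
  \<open>kissing_number TYPE(real^n)\<close>. The maximum is over a finite nonempty set and every
  code is finite, by \<open>finite_kissing_code_cards\<close> and \<open>kissing_code_finite\<close> below, so no
  junk value of \<^const>\<open>Max\<close> or \<^const>\<open>card\<close> is involved.
\<close>

definition kissing_number :: "'a::euclidean_space itself \<Rightarrow> nat" where
  "kissing_number (_ :: 'a itself) = Max {card C | C :: 'a set. kissing_code C}"

lemma kissing_code_bounded:
  "\<exists>N. \<forall>C :: 'a::euclidean_space set. kissing_code C \<longrightarrow> finite C \<and> card C \<le> N"
proof -
  have "compact (sphere (0::'a) 1)" by simp
  then obtain K :: "'a set" where K: "finite K" "sphere 0 1 \<subseteq> (\<Union>x\<in>K. ball x (1/2))"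
    unfolding compact_eq_totally_bounded by (meson half_gt_zero zero_less_one)
  have "finite C \<and> card C \<le> card K" if C: "kissing_code C" for C :: "'a set"
  proof -
    have "\<forall>x\<in>C. \<exists>k. k \<in> K \<and> dist k x < 1/2"
      using C K(2) unfolding kissing_code_def by fastforce
    then obtain f where f: "\<And>x. x \<in> C \<Longrightarrow> f x \<in> K \<and> dist (f x) x < 1/2" by metis
    have "inj_on f C"
    proof (rule inj_onI, rule ccontr)
      fix x y assume xy: "x \<in> C" "y \<in> C" "f x = f y" "x \<noteq> y"
      have "norm x = 1" "norm y = 1" "x \<bullet> y \<le> 1/2"
        using C xy unfolding kissing_code_def by auto
      then have "1 \<le> (norm (x - y))\<^sup>2"
        by (simp add: power2_norm_eq_inner inner_diff inner_commute norm_eq_1)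
      then have "1 \<le> dist x y"
        using power_mono_iff[of 1 "norm (x - y)" 2] by (simp add: dist_norm)
      moreover have "dist x y < 1"
        using f[OF xy(1)] f[OF xy(2)] xy(3) dist_triangle_half_r[of "f x" x 1 y] by simp
      ultimately show False by simp
    qed
    moreover have "f ` C \<subseteq> K" using f by blast
    ultimately show ?thesis
      using K(1) by (meson card_inj_on_le inj_on_finite)
  qed
  then show ?thesis by blast
qed

lemma kissing_code_finite:
  fixes C :: "'a::euclidean_space set"
  shows "kissing_code C \<Longrightarrow> finite C"
  using kissing_code_bounded by blast

lemma finite_kissing_code_cards:
  "finite {card C | C :: 'a::euclidean_space set. kissing_code C}"
  "{card C | C :: 'a::euclidean_space set. kissing_code C} \<noteq> {}"
proof -
  obtain N where "\<forall>C :: 'a set. kissing_code C \<longrightarrow> finite C \<and> card C \<le> N"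
    using kissing_code_bounded by blast
  then have "{card C | C :: 'a set. kissing_code C} \<subseteq> {..N}" by auto
  then show "finite {card C | C :: 'a set. kissing_code C}"
    using finite_subset by blast
  have "kissing_code ({} :: 'a set)" by (simp add: kissing_code_def)
  then show "{card C | C :: 'a set. kissing_code C} \<noteq> {}" by blast
qed

lemma card_le_kissing_number:
  fixes C :: "'a::euclidean_space set"
  assumes "kissing_code C"
  shows "card C \<le> kissing_number TYPE('a)"
  unfolding kissing_number_def
  using assms by (intro Max_ge finite_kissing_code_cards) blast

text \<open>
  The sphere-packing form: \<open>D\<close> is the set of centres of the unit spheres that touch the
  central unit sphere (from the outside, so the centres are at distance 2 from the origin).
\<close>

lemma disjnt_unit_balls_iff:
  fixes x y :: "'a::euclidean_space"
  assumes "norm x = 1" "norm y = 1"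
  shows "disjnt (ball (2 *\<^sub>R x) 1) (ball (2 *\<^sub>R y) 1) \<longleftrightarrow> x \<bullet> y \<le> 1/2"
proof -
  have "disjnt (ball (2 *\<^sub>R x) 1) (ball (2 *\<^sub>R y) 1) \<longleftrightarrow> 2 \<le> dist (2 *\<^sub>R x) (2 *\<^sub>R y)"
  proof
    assume d: "disjnt (ball (2 *\<^sub>R x) 1) (ball (2 *\<^sub>R y) 1)"
    show "2 \<le> dist (2 *\<^sub>R x) (2 *\<^sub>R y)"
    proof (rule ccontr)
      assume "\<not> ?thesis"
      then have "midpoint (2 *\<^sub>R x) (2 *\<^sub>R y) \<in> ball (2 *\<^sub>R x) 1 \<inter> ball (2 *\<^sub>R y) 1"
        by (simp add: dist_midpoint)
      with d show False by (auto simp: disjnt_def)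
    qed
  next
    assume "2 \<le> dist (2 *\<^sub>R x) (2 *\<^sub>R y)"
    then show "disjnt (ball (2 *\<^sub>R x) 1) (ball (2 *\<^sub>R y) 1)"
      unfolding disjnt_def by (simp add: disjoint_ballI)
  qed
  also have "\<dots> \<longleftrightarrow> 1 \<le> norm (x - y)"
    by (simp add: dist_norm flip: scaleR_diff_right)
  also have "\<dots> \<longleftrightarrow> 1 \<le> (norm (x - y))\<^sup>2"
    using power_mono_iff[of 1 "norm (x - y)" 2] by simp
  also have "\<dots> \<longleftrightarrow> x \<bullet> y \<le> 1/2"
    using assms by (simp add: power2_norm_eq_inner inner_diff inner_commute norm_eq_1 mult.commute)
  finally show ?thesis .
qed

lemma kissing_number_eq_spheres:
  "kissing_number TYPE('a::euclidean_space) =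
    Max {card D | D :: 'a set. D \<subseteq> sphere 0 2 \<and> pairwise (\<lambda>c d. disjnt (ball c 1) (ball d 1)) D}"
proof -
  let ?P = "\<lambda>D :: 'a set. D \<subseteq> sphere 0 2 \<and> pairwise (\<lambda>c d. disjnt (ball c 1) (ball d 1)) D"
  have scale: "?P ((*\<^sub>R) 2 ` C) \<longleftrightarrow> kissing_code C" for C :: "'a set"
  proof -
    have "C \<subseteq> sphere 0 1 \<longleftrightarrow> (*\<^sub>R) 2 ` C \<subseteq> sphere 0 2" by (auto simp: subset_iff)
    then show ?thesis
      unfolding kissing_code_def pairwise_image pairwise_def
      using disjnt_unit_balls_iff by (auto simp: subset_iff)
  qed
  have c: "card ((*\<^sub>R) 2 ` C) = card C" for C :: "'a set"
    by (rule card_image) (simp add: inj_on_def)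
  have half: "D = (*\<^sub>R) 2 ` (*\<^sub>R) (1/2) ` D" for D :: "'a set"
    by (simp add: image_image)
  have "{card C | C :: 'a set. kissing_code C} = {card D | D :: 'a set. ?P D}"
  proof (intro equalityI subsetI)
    fix n assume "n \<in> {card C | C :: 'a set. kissing_code C}"
    then obtain C :: "'a set" where "n = card C" "kissing_code C" by blast
    then have "n = card ((*\<^sub>R) 2 ` C) \<and> ?P ((*\<^sub>R) 2 ` C)" using scale[of C] c[of C] by simp
    then show "n \<in> {card D | D :: 'a set. ?P D}" by blast
  next
    fix n assume "n \<in> {card D | D :: 'a set. ?P D}"
    then obtain D :: "'a set" where D: "n = card D" "?P D" by blast
    obtain C where C: "D = (*\<^sub>R) 2 ` C" using half by blast
    have "n = card C" using D(1) c[of C] C by simp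
    moreover have "kissing_code C" using D(2) scale[of C] C by simp
    ultimately show "n \<in> {card C | C :: 'a set. kissing_code C}" by blast
  qed
  then show ?thesis by (simp add: kissing_number_def)
qed

end

theory Submission
  imports Defs
begin

text \<open>
  The minimal vectors of the Leech lattice of shapes \<open>(\<plusminus>4\<^sup>2, 0\<^sup>2\<^sup>2)\<close> and \<open>(\<plusminus>2\<^sup>8, 0\<^sup>1\<^sup>6)\<close>, the latter
  supported on octads of the Golay code, have squared norm 32 and inner products at most 16,
  whether the number of minus signs on the octads is required to be even or odd. Requiring it to be
  odd makes room for more vectors on the first \<open>m\<close> coordinates: take \<open>\<plusminus>a\<close> everywhere, with
  \<open>a = sqrt (32 / m)\<close> and the signs of a Golay codeword. Codewords meet octads evenly, so at least
  one sign disagrees with any odd octad vector, and the inner product is at most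
  \<open>2 * a * 6 \<le> 16\<close> for \<open>m \<ge> 18\<close>. Two such vectors are compatible when their signs differ in at
  least \<open>m / 4\<close> places. For \<open>m = 19, 20, 21\<close> this is arranged by parity conditions on the
  deleted coordinates. In dimensions 17 and 18 one takes \<open>m = 18\<close> and the section by the hyperplane
  where coordinates 16 and 17, respectively 16, 17 and 18, sum to zero; these coordinates lie in
  the octad \<open>{16..<24}\<close>, and only the minus signs on the first 18 coordinates are counted.
\<close>

section \<open>Binary linear codes\<close>

definition wxor :: "bool list \<Rightarrow> bool list \<Rightarrow> bool list" where
  "wxor v w = map2 (\<noteq>) v w"

definition supp :: "bool list \<Rightarrow> nat set" where
  "supp w = {i. i < length w \<and> w ! i}"

definition weight :: "bool list \<Rightarrow> nat" where
  "weight w = length (filter id w)"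

lemma length_wxor: "length v = n \<Longrightarrow> length w = n \<Longrightarrow> length (wxor v w) = n"
  by (simp add: wxor_def)

lemma supp_wxor: "length v = length w \<Longrightarrow> supp (wxor v w) = sym_diff (supp v) (supp w)"
  by (auto simp: supp_def wxor_def)

lemma finite_supp: "finite (supp w)"
  by (simp add: supp_def)

lemma supp_subset: "length w = n \<Longrightarrow> supp w \<subseteq> {..<n}"
  by (auto simp: supp_def)

lemma inj_on_supp: "inj_on supp {w. length w = n}"
proof (rule inj_onI)
  fix v w assume vw: "v \<in> {w. length w = n}" "w \<in> {w. length w = n}" "supp v = supp w"
  have "v ! i = w ! i" if "i < n" for i
  proof -
    have "i \<in> supp v \<longleftrightarrow> i \<in> supp w" by (simp only: vw(3))
    with vw(1,2) that show ?thesis by (simp add: supp_def)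
  qed
  with vw show "v = w" by (simp add: list_eq_iff_nth_eq)
qed

lemma supp_replicate_False: "supp (replicate n False) = {}"
  by (auto simp: supp_def)

lemma card_supp_atLeast: "card (supp w \<inter> {k..}) = weight (drop k w)"
proof -
  have "supp w \<inter> {k..} = (\<lambda>i. i + k) ` {i. i < length (drop k w) \<and> drop k w ! i}"
  proof (intro equalityI subsetI)
    fix i assume "i \<in> supp w \<inter> {k..}"
    then have "i - k \<in> {i. i < length (drop k w) \<and> drop k w ! i}" "i = (i - k) + k"
      by (auto simp: supp_def)
    then show "i \<in> (\<lambda>i. i + k) ` {i. i < length (drop k w) \<and> drop k w ! i}" by blast
  qed (auto simp: supp_def add.commute)
  then show ?thesis
    by (simp add: weight_def length_filter_conv_card card_image)
qed

lemma card_supp: "card (supp w) = weight w"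
  using card_supp_atLeast[of w 0] by simp

lemma even_card_sym_diff:
  assumes "finite A" "finite B"
  shows "even (card (sym_diff A B)) \<longleftrightarrow> (even (card A) \<longleftrightarrow> even (card B))"
proof -
  have "card (sym_diff A B) = card (A - B) + card (B - A)"
    using assms by (intro card_Un_disjoint) auto
  moreover have "card A = card (A - B) + card (A \<inter> B)" "card B = card (B - A) + card (A \<inter> B)"
    using assms card_Int_Diff[of A B] card_Int_Diff[of B A] by (auto simp: Int_commute)
  ultimately show ?thesis by presburger
qed

text \<open>A list rather than a set, so that words can be counted by evaluation. It has no
  repetitions once the generators are \<open>separated\<close> by a positive distance.\<close>

fun span_words :: "nat \<Rightarrow> bool list list \<Rightarrow> bool list list" where
  "span_words n [] = [replicate n False]"
| "span_words n (b # bs) = (let ws = span_words n bs in ws @ map (wxor b) ws)"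

definition linear_code :: "nat \<Rightarrow> bool list list \<Rightarrow> nat set set" where
  "linear_code n bs = supp ` set (span_words n bs)"

abbreviation all_length :: "nat \<Rightarrow> bool list list \<Rightarrow> bool" where
  "all_length n bs \<equiv> \<forall>b\<in>set bs. length b = n"

lemma length_span_words: "all_length n bs \<Longrightarrow> w \<in> set (span_words n bs) \<Longrightarrow> length w = n"
  by (induction bs arbitrary: w) (auto simp: Let_def length_wxor)

lemma linear_code_Nil: "linear_code n [] = {{}}"
  by (simp add: linear_code_def supp_replicate_False)

lemma linear_code_Cons:
  assumes "all_length n (b # bs)"
  shows "linear_code n (b # bs) = linear_code n bs \<union> sym_diff (supp b) ` linear_code n bs"
proof -
  have "supp (wxor b w) = sym_diff (supp b) (supp w)" if "w \<in> set (span_words n bs)" for w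
    using assms that length_span_words[of bs n w] by (intro supp_wxor) auto
  then have "supp ` wxor b ` set (span_words n bs) = sym_diff (supp b) ` supp ` set (span_words n bs)"
    unfolding image_image by (rule image_cong[OF refl])
  then show ?thesis
    unfolding linear_code_def by (simp add: Let_def image_Un)
qed

lemma linear_code_subset: "all_length n bs \<Longrightarrow> c \<in> linear_code n bs \<Longrightarrow> c \<subseteq> {..<n}"
  unfolding linear_code_def using length_span_words supp_subset by blast

lemma linear_code_sym_diff:
  "all_length n bs \<Longrightarrow> c \<in> linear_code n bs \<Longrightarrow> d \<in> linear_code n bs \<Longrightarrow> sym_diff c d \<in> linear_code n bs"
proof (induction bs arbitrary: c d)
  case Nil
  then show ?case by (simp add: linear_code_Nil)
next
  case (Cons b bs)
  let ?C = "linear_code n bs"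
  define h where "h x = sym_diff (supp b) x" for x
  have IH: "sym_diff x y \<in> ?C" if "x \<in> ?C" "y \<in> ?C" for x y
    using Cons that by simp
  have C: "linear_code n (b # bs) = ?C \<union> h ` ?C"
    unfolding h_def by (rule linear_code_Cons[OF Cons.prems(1)])
  have "\<exists>x\<in>?C. c = x \<or> c = h x" "\<exists>y\<in>?C. d = y \<or> d = h y"
    using Cons.prems unfolding C by blast+
  then obtain x y where x: "x \<in> ?C" "c = x \<or> c = h x"
    and y: "y \<in> ?C" "d = y \<or> d = h y" by blast
  define z where "z = sym_diff x y"
  have "sym_diff c d = z \<or> sym_diff c d = h z"
    using x(2) y(2) unfolding z_def h_def by (elim disjE; simp; blast)
  moreover have "z \<in> ?C" using IH[OF x(1) y(1)] by (simp add: z_def)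
  ultimately show ?case unfolding C by (elim disjE) (simp_all only: Un_iff imageI simp_thms)
qed

text \<open>The parity of the intersection with \<open>A\<close> is additive under symmetric
  difference, so it need only be checked on generators.\<close>

lemma linear_code_even_Int:
  assumes "all_length n bs" "\<And>b. b \<in> set bs \<Longrightarrow> even (card (supp b \<inter> A))" "c \<in> linear_code n bs"
  shows "even (card (c \<inter> A))"
  using assms
proof (induction bs arbitrary: c)
  case Nil
  then show ?case by (simp add: linear_code_Nil)
next
  case (Cons b bs)
  have IH: "even (card (x \<inter> A))" if "x \<in> linear_code n bs" for x
    using Cons that by simp
  from Cons.prems(3) consider "c \<in> linear_code n bs" | x where "x \<in> linear_code n bs" "c = sym_diff (supp b) x"
    unfolding linear_code_Cons[OF Cons.prems(1)] by blast
  then show ?case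
  proof cases
    case 2
    have "c \<inter> A = sym_diff (supp b \<inter> A) (x \<inter> A)" unfolding 2(2) by blast
    moreover have "finite x" using 2(1) Cons.prems(1) linear_code_subset[of bs n x] by (simp add: finite_subset)
    ultimately show ?thesis
      using IH[OF 2(1)] Cons.prems(2)[of b] by (simp add: even_card_sym_diff finite_supp)
  qed (rule IH)
qed

text \<open>Linearity is applied in each argument in turn: first with one generator fixed, then with
  the whole word \<open>c\<close> fixed.\<close>

lemma linear_code_even_Int_self:
  assumes bs: "all_length n bs"
    and even: "\<And>a b. a \<in> set bs \<Longrightarrow> b \<in> set bs \<Longrightarrow> even (card (supp a \<inter> supp b))"
    and cd: "c \<in> linear_code n bs" "d \<in> linear_code n bs"
  shows "even (card (c \<inter> d))"
proof -
  have "even (card (supp b \<inter> c))" if "b \<in> set bs" for b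
    using linear_code_even_Int[OF bs _ cd(1), of "supp b"] even that by (simp add: Int_commute)
  then show ?thesis
    using linear_code_even_Int[OF bs _ cd(2), of c] by (simp add: Int_commute)
qed

section \<open>Minimum distance, independence and counting by evaluation\<close>

text \<open>Runs through the coset of \<open>w\<close> by branching on each generator, so that
  evaluation does not build the list of words.\<close>

fun all_translates :: "(bool list \<Rightarrow> bool) \<Rightarrow> bool list list \<Rightarrow> bool list \<Rightarrow> bool" where
  "all_translates P [] w \<longleftrightarrow> P w"
| "all_translates P (b # bs) w \<longleftrightarrow> all_translates P bs w \<and> all_translates P bs (wxor b w)"

lemma all_translates_iff:
  assumes "all_length n bs" "length w = n"
  shows "all_translates P bs w \<longleftrightarrow> (\<forall>v\<in>set (span_words n bs). P (wxor w v))"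
  using assms
proof (induction bs arbitrary: w)
  case Nil
  have "wxor w (replicate n False) = w"
    using Nil by (simp add: wxor_def list_eq_iff_nth_eq)
  then show ?case by simp
next
  case (Cons b bs)
  have "wxor (wxor b w) v = wxor w (wxor b v)" if "v \<in> set (span_words n bs)" for v
    using Cons.prems that length_span_words[of bs n v] by (auto simp: wxor_def list_eq_iff_nth_eq)
  then show ?case
    using Cons by (auto simp: Let_def length_wxor)
qed

text \<open>
  Comparing each generator with the span of its successors yields both the minimum distance and
  the linear independence of the generators.
\<close>

fun separated :: "nat \<Rightarrow> bool list list \<Rightarrow> bool" where
  "separated d [] \<longleftrightarrow> True"
| "separated d (b # bs) \<longleftrightarrow> separated d bs \<and> all_translates (\<lambda>w. d \<le> weight w) bs b"

lemma separated_ConsD: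
  assumes "all_length n (b # bs)" "separated d (b # bs)" "w \<in> set (span_words n bs)"
  shows "d \<le> weight (wxor b w)"
  using assms by (simp add: all_translates_iff[of bs n b])

text \<open>A nonzero word is its first generator plus a word in the span of the later generators,
  which is a pair tested by \<open>separated\<close>.\<close>

lemma separated_linear_code:
  assumes "all_length n bs" "separated d bs" "c \<in> linear_code n bs" "c \<noteq> {}"
  shows "d \<le> card c"
  using assms
proof (induction bs)
  case Nil
  then show ?case by (simp add: linear_code_Nil)
next
  case (Cons b bs)
  from Cons.prems(3) consider "c \<in> linear_code n bs" | w where "w \<in> set (span_words n bs)" "c = supp (wxor b w)"
    by (auto simp: linear_code_def Let_def)
  then show ?case
    using Cons separated_ConsD[OF Cons.prems(1,2)] by cases (auto simp: card_supp)
qed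

lemma distinct_span_words:
  assumes "all_length n bs" "separated d bs" "0 < d"
  shows "distinct (span_words n bs)"
  using assms
proof (induction bs)
  case (Cons b bs)
  let ?W = "set (span_words n bs)"
  have len: "length b = n" "\<And>w. w \<in> ?W \<Longrightarrow> length w = n"
    using Cons.prems(1) length_span_words[of bs n] by auto
  have "inj_on (wxor b) ?W"
  proof (rule inj_onI)
    fix v w assume vw: "v \<in> ?W" "w \<in> ?W" "wxor b v = wxor b w"
    then have "sym_diff (supp b) (supp v) = sym_diff (supp b) (supp w)"
      using len by (metis supp_wxor)
    then have "supp v = supp w" by blast
    then show "v = w" using vw len inj_on_supp[of n] by (auto dest: inj_onD)
  qed
  \<comment> \<open>A coincidence between the two halves would put \<open>b\<close> in the span of
    its successors, against its positive distance from them.\<close>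
  moreover have False if vw: "v \<in> ?W" "w \<in> ?W" "v = wxor b w" for v w
  proof -
    have "sym_diff (supp v) (supp w) \<in> linear_code n bs"
      using vw Cons.prems(1) by (intro linear_code_sym_diff) (auto simp: linear_code_def)
    then obtain u where u: "u \<in> ?W" "supp u = sym_diff (supp v) (supp w)"
      by (auto simp: linear_code_def)
    have "supp v = sym_diff (supp b) (supp w)" using vw len by (simp add: supp_wxor)
    with u(2) have "supp u = supp b" by blast
    then have "supp (wxor b u) = {}" using len u(1) by (simp add: supp_wxor)
    then have "weight (wxor b u) = 0" by (metis card_supp card.empty)
    then show False using Cons.prems(3) separated_ConsD[OF Cons.prems(1,2) u(1)] by simp
  qed
  ultimately show ?case
    using Cons by (auto simp: Let_def distinct_map)
qed simp

lemma card_linear_code_Collect: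
  assumes "all_length n bs" "separated d bs" "0 < d"
  shows "card {c \<in> linear_code n bs. P c} = length (filter (\<lambda>w. P (supp w)) (span_words n bs))"
proof -
  have "{c \<in> linear_code n bs. P c} = supp ` set (filter (\<lambda>w. P (supp w)) (span_words n bs))"
    by (auto simp: linear_code_def)
  moreover have "inj_on supp (set (filter (\<lambda>w. P (supp w)) (span_words n bs)))"
    using length_span_words[OF assms(1)] by (intro inj_on_subset[OF inj_on_supp[of n]]) auto
  ultimately show ?thesis
    using distinct_span_words[OF assms] by (simp add: card_image distinct_card del: set_filter)
qed

lemma card_linear_code:
  assumes "all_length n bs" "separated d bs" "0 < d"
  shows "card (linear_code n bs) = 2 ^ length bs"
proof -
  have "length (span_words n bs) = 2 ^ length bs"
    by (induction bs) (simp_all add: Let_def)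
  then show ?thesis
    using card_linear_code_Collect[OF assms, of "\<lambda>_. True"] by simp
qed

lemma linear_code_drop_subset: "all_length n bs \<Longrightarrow> linear_code n (drop k bs) \<subseteq> linear_code n bs"
proof (induction bs arbitrary: k)
  case (Cons b bs)
  then show ?case
    using linear_code_Cons[of b bs n] by (cases k) auto
qed simp

lemma separated_drop: "separated d bs \<Longrightarrow> separated d (drop k bs)"
  by (induction bs arbitrary: k) (auto simp: drop_Cons split: nat.split)

text \<open>If \<open>C\<close> has an odd word \<open>g\<close>, adding \<open>g\<close> maps the
  odd words injectively to even ones. So the even words make up at least half of
  \<open>C\<close>.\<close>

lemma card_linear_code_even_ge:
  assumes bs: "all_length n bs" and C: "C \<subseteq> linear_code n bs"
    and closed: "\<And>c d. c \<in> C \<Longrightarrow> d \<in> C \<Longrightarrow> sym_diff c d \<in> C"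
  shows "card C \<le> 2 * card {c \<in> C. even (card (c \<inter> A))}" (is "_ \<le> 2 * card ?E")
proof -
  let ?F = "{c \<in> C. odd (card (c \<inter> A))}"
  have fin: "finite C" using C by (rule finite_subset) (simp add: linear_code_def)
  have "card C = card ?E + card ?F"
    using fin by (subst card_Un_disjoint[symmetric]) (auto intro!: arg_cong[where f = card])
  moreover have "card ?F \<le> card ?E"
  proof (cases "?F = {}")
    case False
    then obtain g where g: "g \<in> ?F" by blast
    have "inj_on (\<lambda>c. sym_diff g c) ?F"
      by (rule inj_onI) blast
    moreover have "sym_diff g c \<in> ?E" if c: "c \<in> ?F" for c
    proof -
      have "finite g" "finite c"
        using g c C linear_code_subset[OF bs] by (auto intro: finite_subset[of _ "{..<n}"])
      moreover have "sym_diff g c \<inter> A = sym_diff (g \<inter> A) (c \<inter> A)" by blast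
      ultimately show ?thesis
        using g c closed[of g c] by (simp add: even_card_sym_diff)
    qed
    ultimately show ?thesis
      using fin by (intro card_inj_on_le[of "\<lambda>c. sym_diff g c"]) auto
  next
    case True
    then show ?thesis by (metis card.empty le0)
  qed
  ultimately show ?thesis by simp
qed

section \<open>The Golay code\<close>

text \<open>
  Echelon form from the top coordinate down, so that the words supported on \<open>{..<24 - k}\<close>, for
  \<open>k \<le> 6\<close>, and on \<open>{..<16}\<close>, for \<open>k = 7\<close>, are spanned by \<open>drop k golay_gens\<close>. The complement
  \<open>{16..<24}\<close> of the support of these last words is an octad.
\<close>

definition golay_gens :: "bool list list" where
  "golay_gens = map (\<lambda>xs. map (\<lambda>i. i \<in> set xs) [0..<24])
    [[0, 1, 2, 6, 9, 12, 16, 23],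
     [0, 3, 4, 5, 8, 10, 16, 22],
     [2, 5, 8, 9, 10, 12, 16, 21],
     [1, 2, 3, 4, 8, 12, 16, 20],
     [1, 4, 5, 6, 10, 12, 16, 19],
     [1, 3, 5, 6, 8, 9, 16, 18],
     [2, 3, 4, 6, 9, 10, 16, 17],
     [0, 1, 2, 3, 4, 5, 6, 7],
     [0, 1, 2, 3, 8, 9, 10, 11],
     [0, 1, 4, 5, 8, 9, 12, 13],
     [0, 2, 4, 6, 8, 10, 12, 14],
     [0, 3, 5, 6, 9, 10, 12, 15]]"

definition golay :: "nat set set" where
  "golay = linear_code 24 golay_gens"

lemma length_golay_gens: "all_length 24 golay_gens"
  by (simp add: golay_gens_def)

text \<open>The evaluation visits each of the 4095 nonzero codewords once.\<close>

lemma separated_golay_gens: "separated 8 golay_gens"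
  by code_simp

lemma golay_sym_diff: "c \<in> golay \<Longrightarrow> d \<in> golay \<Longrightarrow> sym_diff c d \<in> golay"
  unfolding golay_def by (rule linear_code_sym_diff[OF length_golay_gens])

lemma golay_min_card: "c \<in> golay \<Longrightarrow> c \<noteq> {} \<Longrightarrow> 8 \<le> card c"
  unfolding golay_def by (rule separated_linear_code[OF length_golay_gens separated_golay_gens])

lemma golay_subset: "c \<in> golay \<Longrightarrow> c \<subseteq> {..<24}"
  unfolding golay_def by (rule linear_code_subset[OF length_golay_gens])

lemma finite_golay: "finite golay"
  by (simp add: golay_def linear_code_def)

lemma golay_even_Int: "c \<in> golay \<Longrightarrow> d \<in> golay \<Longrightarrow> even (card (c \<inter> d))"
proof -
  have "list_all (\<lambda>a. list_all (\<lambda>b. even (weight (map2 (\<and>) a b))) golay_gens) golay_gens"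
    by code_simp
  moreover have "supp (map2 (\<and>) a b) = supp a \<inter> supp b" for a b
    by (auto simp: supp_def)
  ultimately have "even (card (supp a \<inter> supp b))" if "a \<in> set golay_gens" "b \<in> set golay_gens" for a b
    using that by (metis (no_types, lifting) card_supp list_all_iff)
  then show "c \<in> golay \<Longrightarrow> d \<in> golay \<Longrightarrow> even (card (c \<inter> d))"
    unfolding golay_def by (rule linear_code_even_Int_self[OF length_golay_gens])
qed

text \<open>Only lower bounds on the counts are wanted, so enumerating the smaller subcode spanned
  by \<open>drop k golay_gens\<close> suffices. \<open>Q\<close> is the form of \<open>P\<close>
  that can be evaluated on words.\<close>

lemma card_golay_Collect_ge:
  assumes "length (filter Q (span_words 24 (drop k golay_gens))) = N" "\<And>w. Q w \<longleftrightarrow> P (supp w)"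
  shows "N \<le> card {c \<in> golay. P c}"
proof -
  have "card {c \<in> linear_code 24 (drop k golay_gens). P c} \<le> card {c \<in> golay. P c}"
    using linear_code_drop_subset[OF length_golay_gens, of k] finite_golay
    by (intro card_mono) (auto simp: golay_def)
  moreover have "card {c \<in> linear_code 24 (drop k golay_gens). P c}
      = length (filter (\<lambda>w. P (supp w)) (span_words 24 (drop k golay_gens)))"
    using length_golay_gens separated_golay_gens
    by (intro card_linear_code_Collect[of _ _ 8] separated_drop) (auto dest: in_set_dropD)
  moreover have "Q = (\<lambda>w. P (supp w))" using assms(2) by blast
  ultimately show ?thesis using assms(1) by simp
qed

lemma golay_subset_lessThan_iff:
  assumes "c \<in> golay"
  shows "c \<subseteq> {..<n} \<longleftrightarrow> card (c \<inter> {n..}) = 0"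
proof -
  have "finite c" using golay_subset[OF assms] finite_subset by blast
  then show ?thesis by (auto simp: not_le)
qed

text \<open>These are entries of the octad intersection triangle: 30 octads miss a given octad, and
  78, 130, 210 miss five, four, three points. Exactly 16 meet the octad \<open>{16..<24}\<close> in
  a given pair, so 48 meet it in one of the three pairs from \<open>{16, 17, 18}\<close>.\<close>

lemma golay_octad_counts:
  "length (filter (\<lambda>w. weight w = 8 \<and> weight (drop 16 w) = 0) (span_words 24 (drop 7 golay_gens))) = 30"
  "length (filter (\<lambda>w. weight w = 8 \<and> weight (drop 18 w) = 0 \<and> weight (drop 16 w) = 2)
    (span_words 24 (drop 6 golay_gens))) = 16"
  "length (filter (\<lambda>w. weight w = 8 \<and> weight (drop 19 w) = 0 \<and> weight (drop 16 w) = 2)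
    (span_words 24 (drop 5 golay_gens))) = 48"
  "length (filter (\<lambda>w. weight w = 8 \<and> weight (drop 19 w) = 0) (span_words 24 (drop 5 golay_gens))) = 78"
  "length (filter (\<lambda>w. weight w = 8 \<and> weight (drop 20 w) = 0) (span_words 24 (drop 4 golay_gens))) = 130"
  "length (filter (\<lambda>w. weight w = 8 \<and> weight (drop 21 w) = 0) (span_words 24 (drop 3 golay_gens))) = 210"
  by code_simp+

section \<open>Codes of signed vectors\<close>

text \<open>Vectors are handled as functions on indices; a bijection with \<open>Basis\<close> and
  division by \<open>sqrt r\<close> make them unit vectors. Distinct indices give distinct vectors,
  since an inner product cannot be both 1 and at most 1/2.\<close>

lemma kissing_number_ge_card:
  fixes f :: "'i \<Rightarrow> nat \<Rightarrow> real"
  assumes "finite I"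
    and norm: "\<And>p. p \<in> I \<Longrightarrow> (\<Sum>i<DIM('a). f p i * f p i) = r"
    and inner: "\<And>p q. p \<in> I \<Longrightarrow> q \<in> I \<Longrightarrow> p \<noteq> q \<Longrightarrow> (\<Sum>i<DIM('a). f p i * f q i) \<le> r / 2"
    and "0 < r"
  shows "card I \<le> kissing_number TYPE('a::euclidean_space)"
proof -
  obtain e where e: "bij_betw e (Basis :: 'a set) {..<DIM('a)}"
    using ex_bij_betw_finite_nat[OF finite_Basis] by (auto simp: atLeast0LessThan)
  define g :: "'i \<Rightarrow> 'a" where "g p = (\<Sum>b\<in>Basis. (f p (e b) / sqrt r) *\<^sub>R b)" for p
  have g: "g p \<bullet> g q = (\<Sum>i<DIM('a). f p i * f q i) / r" for p q
  proof -
    have "g p \<bullet> b = f p (e b) / sqrt r" if "b \<in> Basis" for p b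
      using that by (simp add: g_def)
    then have "g p \<bullet> g q = (\<Sum>b\<in>Basis. f p (e b) * f q (e b) / r)"
      using \<open>0 < r\<close> by (subst euclidean_inner) simp
    also have "\<dots> = (\<Sum>i<DIM('a). f p i * f q i / r)"
      by (rule sum.reindex_bij_betw[OF e])
    finally show ?thesis by (simp add: sum_divide_distrib)
  qed
  have norm_g: "g p \<bullet> g p = 1" if "p \<in> I" for p
    using norm[OF that] \<open>0 < r\<close> by (simp add: g)
  have inner_g: "g p \<bullet> g q \<le> 1/2" if "p \<in> I" "q \<in> I" "p \<noteq> q" for p q
    using inner[OF that] \<open>0 < r\<close> by (simp add: g field_simps)
  have "inj_on g I"
    using norm_g inner_g by (intro inj_onI) (metis half_gt_zero less_irrefl not_le field_sum_of_halves less_add_same_cancel1 zero_less_one)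
  moreover have "kissing_code (g ` I)"
    using norm_g inner_g by (auto simp: kissing_code_def norm_eq_1)
  ultimately show ?thesis
    using card_le_kissing_number[of "g ` I"] by (simp add: card_image)
qed

definition signed :: "real \<Rightarrow> nat set \<Rightarrow> nat set \<Rightarrow> nat \<Rightarrow> real" where
  "signed a A S i = (if i \<in> A then if i \<in> S then - a else a else 0)"

text \<open>A common position contributes \<open>a * b\<close> where the signs agree and
  \<open>- a * b\<close> where they disagree, that is, on \<open>sym_diff S T\<close>.\<close>

lemma sum_signed_mult:
  assumes "A \<subseteq> {..<n}" "B \<subseteq> {..<n}"
  shows "(\<Sum>i<n. signed a A S i * signed b B T i)
    = a * b * (real (card (A \<inter> B)) - 2 * real (card (sym_diff S T \<inter> (A \<inter> B))))"
proof -
  let ?D = "sym_diff S T"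
  have fin: "finite (A \<inter> B)" using assms finite_subset by blast
  have "(\<Sum>i<n. signed a A S i * signed b B T i)
      = (\<Sum>i\<in>A \<inter> B. a * b * (1 - 2 * (if i \<in> ?D then 1 else 0)))"
    using assms by (intro sum.mono_neutral_cong_right) (auto simp: signed_def)
  also have "\<dots> = a * b * (real (card (A \<inter> B)) - 2 * (\<Sum>i\<in>A \<inter> B. if i \<in> ?D then 1 else 0))"
    by (simp add: sum_distrib_left[symmetric] sum_subtractf)
  also have "(\<Sum>i\<in>A \<inter> B. if i \<in> ?D then 1 else 0) = real (card (?D \<inter> (A \<inter> B)))"
    using fin by (subst sum.inter_restrict[symmetric]) (auto simp: Int_commute)
  finally show ?thesis .
qed

lemma sum_signed_balanced:
  assumes "finite T" "card (A \<inter> T) = 2 * card (S \<inter> T)" "S \<inter> T \<subseteq> A"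
  shows "(\<Sum>i\<in>T. signed a A S i) = 0"
proof -
  have "(\<Sum>i\<in>T. signed a A S i) = (\<Sum>i\<in>A \<inter> T. a - 2 * a * (if i \<in> S then 1 else 0))"
    using assms by (intro sum.mono_neutral_cong_right) (auto simp: signed_def)
  also have "\<dots> = a * real (card (A \<inter> T)) - 2 * a * (\<Sum>i\<in>A \<inter> T. if i \<in> S then 1 else 0)"
    by (simp add: sum_subtractf sum_distrib_left mult.commute)
  also have "(\<Sum>i\<in>A \<inter> T. if i \<in> S then 1 else 0) = real (card (S \<inter> T))"
  proof -
    have "A \<inter> T \<inter> S = S \<inter> T" using assms(3) by blast
    then show ?thesis using assms(1) sum.inter_restrict[of "A \<inter> T" "\<lambda>_. 1::real" S] by simp
  qed
  finally show ?thesis using assms(2) by simp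
qed

text \<open>
  By the preceding lemma, balanced sign patterns give vectors in the hyperplane
  \<open>(\<Sum>i\<in>T. x i) = 0\<close>; for \<open>T = {}\<close> the condition is void.
\<close>

definition balanced :: "nat set \<Rightarrow> nat set \<Rightarrow> nat set \<Rightarrow> bool" where
  "balanced T A S \<longleftrightarrow> card (A \<inter> T) = 2 * card (S \<inter> T)"

definition signed_pairs :: "nat \<Rightarrow> nat set \<Rightarrow> (nat set \<times> nat set) set" where
  "signed_pairs n T = {(A, S). A \<subseteq> {..<n} \<and> card A = 2 \<and> S \<subseteq> A \<and> balanced T A S}"

definition signed_octads :: "nat set set \<Rightarrow> nat \<Rightarrow> nat \<Rightarrow> nat set \<Rightarrow> (nat set \<times> nat set) set" where
  "signed_octads G m n T = {(A, S). A \<in> G \<and> A \<subseteq> {..<n} \<and> card A = 8 \<and> S \<subseteq> A \<and>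
     balanced T A S \<and> odd (card (S \<inter> {..<m}))}"

lemma finite_signed_pairs: "finite (signed_pairs n T)"
  by (rule finite_subset[of _ "Pow {..<n} \<times> Pow {..<n}"]) (auto simp: signed_pairs_def)

lemma finite_signed_octads: "finite (signed_octads G m n T)"
  by (rule finite_subset[of _ "Pow {..<n} \<times> Pow {..<n}"]) (auto simp: signed_octads_def)

lemma card_add_card_sym_diff:
  assumes "finite A" "finite B"
  shows "card A + card B = card (sym_diff A B) + 2 * card (A \<inter> B)"
proof -
  have "card (sym_diff A B) = card (A - B) + card (B - A)"
    using assms by (intro card_Un_disjoint) auto
  then show ?thesis
    using assms card_Int_Diff[of A B] card_Int_Diff[of B A] by (simp add: Int_commute)
qed

text \<open>The three families are joined as a disjoint sum, and inner products are bounded for each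
  pair of families. \<open>\<phi>\<close> carries the hyperplane of vectors with sum zero over
  \<open>T\<close> isometrically to \<open>DIM('a)\<close> coordinates.\<close>

lemma card_sum_construction_le_kissing_number:
  fixes G D :: "nat set set" and \<phi> :: "(nat \<Rightarrow> real) \<Rightarrow> nat \<Rightarrow> real"
  assumes sym_diff: "\<And>c d. c \<in> G \<Longrightarrow> d \<in> G \<Longrightarrow> sym_diff c d \<in> G"
    and dist: "\<And>c. c \<in> G \<Longrightarrow> c \<noteq> {} \<Longrightarrow> 8 \<le> card c"
    and even: "\<And>c d. c \<in> G \<Longrightarrow> d \<in> G \<Longrightarrow> even (card (c \<inter> d))"
    and m: "18 \<le> m" "m \<le> n" "n \<le> Suc m"
    and T: "T \<subseteq> {..<n}" "{..<n} - T \<subseteq> {..<m}"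
    and D: "D \<subseteq> G" "finite D" "\<And>c. c \<in> D \<Longrightarrow> c \<inter> {..<n} \<subseteq> {..<m}"
      "\<And>c. c \<in> D \<Longrightarrow> balanced T {..<m} (c \<inter> {..<m})"
      "\<And>c d. c \<in> D \<Longrightarrow> d \<in> D \<Longrightarrow> c \<noteq> d \<Longrightarrow> m \<le> 4 * card (sym_diff c d \<inter> {..<m})"
    and \<phi>: "\<And>x y. (\<Sum>i\<in>T. x i) = 0 \<Longrightarrow> (\<Sum>i\<in>T. y i) = 0 \<Longrightarrow>
      (\<Sum>i<DIM('a). \<phi> x i * \<phi> y i) = (\<Sum>i<n. x i * y i)"
  shows "card (signed_pairs n T) + card (signed_octads G m n T) + card D
    \<le> kissing_number TYPE('a::euclidean_space)"
proof -
  let ?P = "signed_pairs n T" and ?O = "signed_octads G m n T"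
  \<comment> \<open>This gives the vectors from \<open>D\<close> squared norm 32. The bound
    \<open>a \<le> 4/3\<close> from \<open>18 \<le> m\<close> makes \<open>2 * a * 6\<close> and
    \<open>4 * a * 2\<close> at most 16.\<close>
  define a where "a = sqrt (32 / m)"
  have a: "0 < a" "a * a * m = 32" "a \<le> 4/3"
  proof -
    show "0 < a" "a * a * m = 32" using m by (auto simp: a_def)
    have "32 / real m \<le> (4/3)\<^sup>2" using m by (simp add: field_simps power2_eq_square)
    then show "a \<le> 4/3" unfolding a_def by (intro real_le_lsqrt) auto
  qed
  define f where "f = case_sum (\<lambda>(A, S). signed 4 A S)
    (case_sum (\<lambda>(A, S). signed 2 A S) (\<lambda>c. signed a {..<m} (c \<inter> {..<m})))"
  define I where "I = ?P <+> (?O <+> D)"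
  have mn: "{..<m} \<subseteq> {..<n}" using m by auto
  have finT: "finite T" using T finite_subset by blast

  have P: "A \<subseteq> {..<n}" "card A = 2" "S \<subseteq> A" "balanced T A S" "finite A" if "(A, S) \<in> ?P" for A S
    using that by (auto simp: signed_pairs_def finite_subset)
  have O: "A \<in> G" "A \<subseteq> {..<n}" "card A = 8" "S \<subseteq> A" "balanced T A S" "odd (card (S \<inter> {..<m}))"
    "finite A" if "(A, S) \<in> ?O" for A S
    using that by (auto simp: signed_octads_def finite_subset)

  have I_iff: "p \<in> I \<longleftrightarrow> (\<exists>A S. p = Inl (A, S) \<and> (A, S) \<in> ?P) \<or>
    (\<exists>A S. p = Inr (Inl (A, S)) \<and> (A, S) \<in> ?O) \<or> (\<exists>c. p = Inr (Inr c) \<and> c \<in> D)" for p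
    by (auto simp: I_def)
  have zero: "(\<Sum>i\<in>T. f p i) = 0" if p: "p \<in> I" for p
  proof -
    have *: "(\<Sum>i\<in>T. signed k A S i) = 0" if "balanced T A S" "S \<subseteq> A" for k A S
      using that by (intro sum_signed_balanced[OF finT]) (auto simp: balanced_def)
    from p show ?thesis
      unfolding I_iff
      by (elim disjE exE conjE) (simp_all add: f_def * P(3,4) O(4,5) D(4))
  qed
  define ip where "ip x y = (\<Sum>i<n. x i * y i)" for x y :: "nat \<Rightarrow> real"
  have ip_commute: "ip x y = ip y x" for x y
    by (simp add: ip_def mult.commute)
  have ip: "ip (signed k A S) (signed l B R)
    = k * l * (real (card (A \<inter> B)) - 2 * real (card (sym_diff S R \<inter> (A \<inter> B))))"
    if "A \<subseteq> {..<n}" "B \<subseteq> {..<n}" for k l A B S R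
    using sum_signed_mult[OF that] by (simp add: ip_def)
  have ip_le: "ip (signed k A S) (signed l B R) \<le> k * l * real d"
    if "A \<subseteq> {..<n}" "B \<subseteq> {..<n}" "card (A \<inter> B) \<le> d" "0 \<le> k" "0 \<le> l" for k l A B S R d
    unfolding ip[OF that(1,2)] using that by (intro mult_left_mono) auto

  have norm: "ip (f p) (f p) = 32" if p: "p \<in> I" for p
    using p a(2) unfolding I_iff
    by (elim disjE exE conjE) (simp_all add: f_def ip P(1,2) O(2,3) m(2))

  have PP: "ip (signed 4 A S) (signed 4 B R) \<le> 16" if "(A, S) \<in> ?P" "(B, R) \<in> ?P" "(A, S) \<noteq> (B, R)"
    for A S B R
  proof (cases "A = B")
    case True
    have "sym_diff S R \<inter> (A \<inter> B) \<noteq> {}" using P(3)[OF that(1)] P(3)[OF that(2)] that(3) True by auto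
    then have "card (sym_diff S R \<inter> (A \<inter> B)) \<noteq> 0" using P(5)[OF that(1)] by auto
    moreover have "card (A \<inter> B) = 2" using True P(2)[OF that(1)] by simp
    ultimately show ?thesis using P(1)[OF that(1)] P(1)[OF that(2)] by (simp add: ip)
  next
    case False
    have "card (A \<inter> B) \<noteq> 2"
      using P(2,5)[OF that(1)] P(2,5)[OF that(2)] False
      by (metis card_subset_eq inf_le1 inf_le2)
    moreover have "card (A \<inter> B) \<le> 2" using P(2,5)[OF that(1)] by (metis card_mono inf_le1)
    ultimately show ?thesis
      using ip_le[of A B 1 4 4 S R] P(1)[OF that(1)] P(1)[OF that(2)] by simp
  qed
  have PO: "ip (signed 4 A S) (signed 2 B R) \<le> 16" if "(A, S) \<in> ?P" "(B, R) \<in> ?O" for A S B R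
  proof -
    have "card (A \<inter> B) \<le> 2" using P(2,5)[OF that(1)] by (metis card_mono inf_le1)
    then show ?thesis using ip_le[of A B 2 4 2 S R] P(1)[OF that(1)] O(2)[OF that(2)] by simp
  qed
  have PD: "ip (signed 4 A S) (signed a {..<m} R) \<le> 16" if "(A, S) \<in> ?P" for A S R
  proof -
    have "card (A \<inter> {..<m}) \<le> 2" using P(2,5)[OF that] by (metis card_mono inf_le1)
    then have "ip (signed 4 A S) (signed a {..<m} R) \<le> 4 * a * 2"
      using ip_le[of A "{..<m}" 2 4 a S R] P(1)[OF that] mn a by simp
    then show ?thesis using a by simp
  qed
  have OO: "ip (signed 2 A S) (signed 2 B R) \<le> 16" if "(A, S) \<in> ?O" "(B, R) \<in> ?O" "(A, S) \<noteq> (B, R)"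
    for A S B R
  proof (cases "A = B")
    case True
    note 1 = O[OF that(1)] and 2 = O[OF that(2)]
    have fin: "finite S" "finite R" using 1 2 finite_subset by blast+
    \<comment> \<open>Since \<open>n \<le> Suc m\<close>, signings of the same octad that agree
      below \<open>m\<close> can differ only at coordinate \<open>m\<close>. That coordinate would
      lie in \<open>T\<close>, where balance fixes the number of minus signs.\<close>
    have "S \<inter> {..<m} \<noteq> R \<inter> {..<m}"
    proof
      assume eq: "S \<inter> {..<m} = R \<inter> {..<m}"
      have *: "X = Y" if "card (X \<inter> T) = card (Y \<inter> T)" "X \<inter> {..<m} = Y \<inter> {..<m}"
        "X \<subseteq> {..<n}" "Y \<subseteq> {..<n}" "m \<notin> X" for X Y
      proof (rule ccontr)
        assume "X \<noteq> Y"
        have "X \<subseteq> {..<m}"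
        proof
          fix i assume "i \<in> X"
          with that(3,5) have "i < n" "i \<noteq> m" by auto
          with m show "i \<in> {..<m}" by simp
        qed
        then have "X \<subseteq> Y" using that by blast
        moreover have "Y \<subseteq> insert m X"
        proof
          fix i assume "i \<in> Y"
          with that(4) m have "i < m \<or> i = m" by auto
          then show "i \<in> insert m X" using \<open>i \<in> Y\<close> that(2) by blast
        qed
        ultimately have Y: "Y = insert m X" using \<open>X \<noteq> Y\<close> by blast
        then have "m \<in> T" using that(4) T(2) by blast
        moreover have "finite X" using that(3) finite_subset by blast
        ultimately show False using that(1,5) Y by (simp add: Int_insert_left)
      qed
      have c: "card (S \<inter> T) = card (R \<inter> T)" using 1(5) 2(5) True by (simp add: balanced_def)
      have sub: "S \<subseteq> {..<n}" "R \<subseteq> {..<n}" using 1 2 by blast+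
      have "S = R"
      proof (cases "m \<in> S \<and> m \<in> R")
        case True
        then have "i \<in> S \<longleftrightarrow> i \<in> R" for i
        proof (cases "i < m")
          case False
          then have "i = m \<or> \<not> i < n" using m by auto
          then show ?thesis using True sub by blast
        qed (use eq in blast)
        then show ?thesis by blast
      next
        case False
        then show ?thesis using *[OF c eq sub] *[OF c[symmetric] eq[symmetric] sub(2,1)] by blast
      qed
      then show False using that(3) True by simp
    qed
    \<comment> \<open>Both signings have oddly many minus signs below \<open>m\<close>, so they
      differ there in an even positive number of places. With at least two disagreements the product
      is at most \<open>4 * (8 - 4)\<close>.\<close>
    moreover have "even (card (sym_diff (S \<inter> {..<m}) (R \<inter> {..<m})))"
      using 1(6) 2(6) fin by (subst even_card_sym_diff) auto
    moreover have "card (sym_diff (S \<inter> {..<m}) (R \<inter> {..<m})) \<noteq> 0" if "S \<inter> {..<m} \<noteq> R \<inter> {..<m}"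
      using that by auto
    ultimately have "2 \<le> card (sym_diff (S \<inter> {..<m}) (R \<inter> {..<m}))"
      by (metis One_nat_def dvd_refl even_add less_2_cases not_less odd_one)
    also have "\<dots> \<le> card (sym_diff S R \<inter> (A \<inter> B))"
      using 1 2 True fin by (intro card_mono) auto
    finally show ?thesis using 1 2 True by (simp add: ip)
  next
    case False
    note 1 = O[OF that(1)] and 2 = O[OF that(2)]
    have "8 \<le> card (sym_diff A B)" using 1 2 False by (intro dist sym_diff) auto
    then have "card (A \<inter> B) \<le> 4" using card_add_card_sym_diff[of A B] 1 2 by simp
    then show ?thesis using ip_le[of A B 4 2 2 S R] 1 2 by simp
  qed
  have OD: "ip (signed 2 A S) (signed a {..<m} (c \<inter> {..<m})) \<le> 16" if "(A, S) \<in> ?O" "c \<in> D" for A S c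
  proof -
    note 1 = O[OF that(1)]
    let ?K = "{..<m}"
    let ?X = "sym_diff S (c \<inter> ?K) \<inter> (A \<inter> ?K)"
    \<comment> \<open>Words of \<open>D\<close> have no point between \<open>m\<close> and
      \<open>n\<close>, so truncation at \<open>m\<close> keeps the whole of
      \<open>c \<inter> A\<close> and its even size. The odd number of minus signs in
      \<open>S\<close> then forces a disagreement.\<close>
    have "c \<inter> A \<subseteq> ?K" using 1(2) D(3)[OF that(2)] by blast
    then have X: "?X = sym_diff (S \<inter> ?K) (c \<inter> A)" using 1(4) by blast
    have "finite S" using 1 finite_subset by blast
    moreover have "even (card (c \<inter> A))" using 1(1) D(1) that(2) even by blast
    ultimately have "odd (card ?X)"
      unfolding X using 1(6,7) by (subst even_card_sym_diff) auto
    then have "1 \<le> card ?X" by (cases "card ?X") auto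
    moreover have "card (A \<inter> ?K) \<le> 8" using 1(3,7) by (metis card_mono inf_le1)
    ultimately have "ip (signed 2 A S) (signed a ?K (c \<inter> ?K)) \<le> 2 * a * 6"
      unfolding ip[OF 1(2) mn] using a(1) by (intro mult_left_mono) auto
    then show ?thesis using a by simp
  qed
  have DD: "ip (signed a {..<m} (c \<inter> {..<m})) (signed a {..<m} (d \<inter> {..<m})) \<le> 16"
    if "c \<in> D" "d \<in> D" "c \<noteq> d" for c d
  proof -
    let ?K = "{..<m}"
    let ?X = "sym_diff (c \<inter> ?K) (d \<inter> ?K) \<inter> (?K \<inter> ?K)"
    have "?X = sym_diff c d \<inter> ?K" by blast
    \<comment> \<open>Disagreement in a quarter of the places halves the product:
      \<open>a * a * m / 2 = 16\<close>.\<close>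
    then have "m \<le> 4 * card ?X" using D(5)[OF that] by simp
    then have "real m - 2 * real (card ?X) \<le> m / 2" by simp
    then have "a * a * (real m - 2 * real (card ?X)) \<le> a * a * (m / 2)"
      using a(1) by (intro mult_left_mono) auto
    then show ?thesis using a(2) by (simp add: ip[OF mn mn])
  qed
  have inner: "ip (f p) (f q) \<le> 16" if pq: "p \<in> I" "q \<in> I" "p \<noteq> q" for p q
    using pq unfolding I_iff
    by (elim disjE exE conjE; simp add: f_def)
        (use PP PO PD OO OD DD in \<open>auto simp: ip_commute[of "signed 2 _ _" "signed 4 _ _"]
          ip_commute[of "signed a _ _" "signed 4 _ _"] ip_commute[of "signed a _ _" "signed 2 _ _"]\<close>)
  have "card I \<le> kissing_number TYPE('a)"
  proof (rule kissing_number_ge_card[where f = "\<lambda>p. \<phi> (f p)" and r = 32])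
    show "finite I" using D(2) by (simp add: I_def finite_signed_pairs finite_signed_octads)
    show "(\<Sum>i<DIM('a). \<phi> (f p) i * \<phi> (f p) i) = 32" if "p \<in> I" for p
      using \<phi>[OF zero[OF that] zero[OF that]] norm[OF that] by (simp add: ip_def)
    show "(\<Sum>i<DIM('a). \<phi> (f p) i * \<phi> (f q) i) \<le> 32 / 2" if "p \<in> I" "q \<in> I" "p \<noteq> q" for p q
      using \<phi>[OF zero zero] inner that by (simp add: ip_def)
  qed simp
  moreover have "card I = card ?P + card ?O + card D"
    using D(2) by (simp add: I_def card_Plus finite_signed_pairs finite_signed_octads)
  ultimately show ?thesis by simp
qed

section \<open>Counting signed octads and signed pairs\<close>

text \<open>Take the signs on \<open>T\<close> from \<open>H\<close> and choose freely outside
  \<open>T\<close> except at one coordinate \<open>a\<close>. The sign at \<open>a\<close>, which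
  lies in \<open>K\<close>, is then used to correct the parity.\<close>

lemma card_signings_ge:
  assumes A: "finite A" "A - T \<subseteq> K" "A - T \<noteq> {}" and H: "H \<subseteq> Pow (A \<inter> T)"
  shows "card H * 2 ^ (card (A - T) - 1) \<le> card {S. S \<subseteq> A \<and> S \<inter> T \<in> H \<and> odd (card (S \<inter> K))}"
    (is "_ \<le> card ?R")
proof -
  obtain a where a: "a \<in> A" "a \<notin> T" "a \<in> K" using A by blast
  define B where "B = A - T - {a}"
  define g where "g = (\<lambda>(h, R). if odd (card ((h \<union> R) \<inter> K)) then h \<union> R else insert a (h \<union> R))"
  have "inj_on g (H \<times> Pow B)"
  proof (rule inj_on_inverseI[where g = "\<lambda>S. (S \<inter> T, S - T - {a})"])
    fix x assume "x \<in> H \<times> Pow B"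
    then show "(g x \<inter> T, g x - T - {a}) = x"
      using H a by (cases x) (auto simp: g_def B_def)
  qed
  moreover have "g ` (H \<times> Pow B) \<subseteq> ?R"
  proof
    fix S assume "S \<in> g ` (H \<times> Pow B)"
    then obtain h R where hR: "h \<in> H" "R \<subseteq> B" "S = g (h, R)" by auto
    let ?U = "h \<union> R"
    have U: "?U \<subseteq> A" "a \<notin> ?U" "?U \<inter> T = h" using hR H a by (auto simp: B_def)
    then have "finite ?U" using A(1) finite_subset by blast
    then have "odd (card (S \<inter> K))" using U(2) a(3) by (auto simp: hR(3) g_def)
    moreover have "S \<subseteq> A" "S \<inter> T = h" using U a by (auto simp: hR(3) g_def)
    ultimately show "S \<in> ?R" using hR(1) by simp
  qed
  moreover have "finite ?R" using A(1) by (auto intro: finite_subset[of _ "Pow A"])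
  ultimately have "card (H \<times> Pow B) \<le> card ?R" using card_inj_on_le by blast
  moreover have "card (Pow B) = 2 ^ (card (A - T) - 1)"
    using A(1) a by (simp add: B_def card_Pow)
  ultimately show ?thesis by (simp add: card_cartesian_product)
qed

text \<open>An octad missing \<open>T\<close> has \<open>2 ^ 7\<close> odd signings. One meeting
  \<open>T\<close> in two points has one minus sign there, giving two choices, times
  \<open>2 ^ 5\<close> for the other six points.\<close>

lemma card_signed_octads_ge:
  assumes T: "{..<n} - T \<subseteq> {..<m}"
  shows "128 * card {c \<in> G. c \<subseteq> {..<n} \<and> card c = 8 \<and> c \<inter> T = {}}
    + 64 * card {c \<in> G. c \<subseteq> {..<n} \<and> card c = 8 \<and> card (c \<inter> T) = 2}
    \<le> card (signed_octads G m n T)" (is "128 * card ?A + 64 * card ?B \<le> _")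
proof -
  define F where "F c = {S. S \<subseteq> c \<and> balanced T c S \<and> odd (card (S \<inter> {..<m}))}" for c
  have finAB: "finite ?A" "finite ?B"
    by (rule finite_subset[of _ "Pow {..<n}"]; auto)+
  have finF: "finite (F c)" if "c \<in> ?A \<union> ?B" for c
  proof -
    have "finite c" using that finite_subset by blast
    then show ?thesis unfolding F_def by (auto intro: finite_subset[of _ "Pow c"])
  qed
  have A: "128 \<le> card (F c)" if c: "c \<in> ?A" for c
  proof -
    have fin: "finite c" using c finite_subset by blast
    have "c - T = c" "c \<inter> T = {}" "c - T \<subseteq> {..<m}" using c T by blast+
    moreover have "c \<noteq> {}" using c by auto
    ultimately have "128 \<le> card {S. S \<subseteq> c \<and> S \<inter> T \<in> {{}} \<and> odd (card (S \<inter> {..<m}))}"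
      using card_signings_ge[OF fin, of T "{..<m}" "{{}}"] c by simp
    also have "\<dots> \<le> card (F c)"
      using c finF[of c] by (intro card_mono) (auto simp: F_def balanced_def)
    finally show ?thesis .
  qed
  have B: "64 \<le> card (F c)" if c: "c \<in> ?B" for c
  proof -
    have fin: "finite c" using c finite_subset by blast
    have "card (c - T) = 6" using c fin card_Int_Diff[of c T] by simp
    moreover have "c - T \<noteq> {}" using calculation by (metis card.empty zero_neq_numeral)
    moreover have "c - T \<subseteq> {..<m}" using c T by blast
    moreover have "card {h. h \<subseteq> c \<inter> T \<and> card h = 1} = 2"
      using c fin by (subst n_subsets) auto
    ultimately have "64 \<le> card {S. S \<subseteq> c \<and> S \<inter> T \<in> {h. h \<subseteq> c \<inter> T \<and> card h = 1} \<and> odd (card (S \<inter> {..<m}))}"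
      using card_signings_ge[OF fin, of T "{..<m}" "{h. h \<subseteq> c \<inter> T \<and> card h = 1}"] by auto
    also have "\<dots> \<le> card (F c)"
      using c finF[of c] by (intro card_mono) (auto simp: F_def balanced_def)
    finally show ?thesis .
  qed
  have "?A \<inter> ?B = {}" by auto
  have "128 * card ?A + 64 * card ?B \<le> (\<Sum>c\<in>?A. card (F c)) + (\<Sum>c\<in>?B. card (F c))"
    using sum_bounded_below[of ?A 128 "\<lambda>c. card (F c)"] sum_bounded_below[of ?B 64 "\<lambda>c. card (F c)"] A B
    by (simp add: mult.commute)
  also have "\<dots> = (\<Sum>c\<in>?A \<union> ?B. card (F c))"
    using finAB \<open>?A \<inter> ?B = {}\<close> by (simp add: sum.union_disjoint)
  also have "\<dots> = card (Sigma (?A \<union> ?B) F)"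
    using finAB finF by (intro card_SigmaI[symmetric]) auto
  also have "\<dots> \<le> card (signed_octads G m n T)"
    by (intro card_mono finite_signed_octads) (auto simp: signed_octads_def F_def)
  finally show ?thesis .
qed

text \<open>A pair outside \<open>T\<close> carries all four signings. A pair inside
  \<open>T\<close> must have opposite signs, so it is an ordered pair \<open>(p, q)\<close> with the
  minus sign at \<open>p\<close>.\<close>

lemma card_signed_pairs_ge:
  assumes "T \<subseteq> {..<n}"
  shows "4 * (card ({..<n} - T) choose 2) + card T * (card T - 1) \<le> card (signed_pairs n T)"
proof -
  let ?A = "{A. A \<subseteq> {..<n} - T \<and> card A = 2}"
  let ?g = "\<lambda>(p, q). ({p, q}, {p})"
  have fin: "finite T" using assms finite_subset by blast
  have finA: "finite ?A" by (rule finite_subset[of _ "Pow {..<n}"]) auto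
  have "card (Sigma ?A Pow) = (\<Sum>A\<in>?A. card (Pow A))"
    using finA by (intro card_SigmaI) (auto intro: finite_subset[of _ "{..<n}"])
  also have "\<dots> = (\<Sum>A\<in>?A. 4)"
    by (intro sum.cong) (auto simp: card_Pow card_ge_0_finite)
  also have "\<dots> = 4 * (card ({..<n} - T) choose 2)"
    by (simp add: n_subsets)
  finally have 1: "card (Sigma ?A Pow) = 4 * (card ({..<n} - T) choose 2)" .
  have "inj_on ?g (Sigma T (\<lambda>p. T - {p}))"
    by (auto simp: inj_on_def doubleton_eq_iff)
  then have 2: "card (?g ` Sigma T (\<lambda>p. T - {p})) = card T * (card T - 1)"
    using fin by (simp add: card_image card_Diff_singleton)
  have "(A, S) \<in> signed_pairs n T" if "(A, S) \<in> Sigma ?A Pow" for A S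
  proof -
    have "A \<inter> T = {}" "S \<inter> T = {}" using that by auto
    then show ?thesis using that by (auto simp: signed_pairs_def balanced_def)
  qed
  moreover have "?g (p, q) \<in> signed_pairs n T" if "p \<in> T" "q \<in> T" "p \<noteq> q" for p q
    using that assms by (auto simp: signed_pairs_def balanced_def Int_insert_left)
  ultimately have "Sigma ?A Pow \<union> ?g ` Sigma T (\<lambda>p. T - {p}) \<subseteq> signed_pairs n T" by auto
  then have "card (Sigma ?A Pow \<union> ?g ` Sigma T (\<lambda>p. T - {p})) \<le> card (signed_pairs n T)"
    by (intro card_mono finite_signed_pairs)
  moreover have "Sigma ?A Pow \<inter> ?g ` Sigma T (\<lambda>p. T - {p}) = {}" by auto
  moreover have "finite (Sigma ?A Pow)"
    using finA by (intro finite_SigmaI) (auto intro: finite_subset[of _ "{..<n}"])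
  ultimately show ?thesis using 1 2 fin by (simp add: card_Un_disjoint)
qed

section \<open>Sections of the Golay construction\<close>

text \<open>
  The words of \<open>split_heads n\<close> (\<open>n \<ge> 18\<close>) meet \<open>{16..}\<close> in \<open>{p, i}\<close> with \<open>p \<in> {16, 17}\<close> and
  \<open>i \<ge> n\<close>; \<open>golay_reps (24 - n)\<close> contains one word for each such pair.
\<close>

definition golay_reps :: "nat \<Rightarrow> bool list list" where
  "golay_reps k = take k golay_gens @ map (wxor (golay_gens ! 6)) (take k golay_gens)"

definition split_heads :: "nat \<Rightarrow> nat set set" where
  "split_heads n = {c \<in> golay. card (c \<inter> {16..}) = 2 \<and> card (c \<inter> {18..}) = 1 \<and> card (c \<inter> {n..}) = 1}"

lemma card_golay: "card golay = 4096"
  unfolding golay_def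
  by (subst card_linear_code[OF length_golay_gens separated_golay_gens]) (simp_all add: golay_gens_def)

lemma golay_gens_supp: "b \<in> set golay_gens \<Longrightarrow> supp b \<in> golay"
proof -
  have "supp b \<in> linear_code n bs" if "b \<in> set bs" "\<forall>b\<in>set bs. length b = n" for n bs
    using that
  proof (induction bs)
    case (Cons a bs)
    have "{} \<in> linear_code n bs" for bs
      using supp_replicate_False[of n] by (induction bs) (auto simp: linear_code_def Let_def)
    then have "supp a \<in> sym_diff (supp a) ` linear_code n bs" by (auto intro!: image_eqI[of _ _ "{}"])
    then show ?case using Cons linear_code_Cons[of a bs n] by auto
  qed simp
  then show "b \<in> set golay_gens \<Longrightarrow> supp b \<in> golay"
    unfolding golay_def using length_golay_gens by blast
qed

lemma golay_reps:
  assumes "r \<in> set (golay_reps k)"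
  shows "length r = 24 \<and> supp r \<in> golay"
proof -
  have "golay_gens ! 6 \<in> set golay_gens" by (rule nth_mem) (simp add: golay_gens_def)
  then show ?thesis
    using assms length_golay_gens golay_gens_supp golay_sym_diff
    by (auto simp: golay_reps_def length_wxor supp_wxor dest!: in_set_takeD)
qed

text \<open>Adding one of the 32 codewords supported on \<open>{..<16}\<close> leaves the
  coordinates from 16 on unchanged. Representatives with distinct tails there therefore give
  disjoint cosets inside \<open>split_heads n\<close>.\<close>

lemma card_split_heads_ge:
  assumes dist: "distinct (map (drop 16) (golay_reps k))"
    and heads: "list_all (\<lambda>r. weight (drop 16 r) = 2 \<and> weight (drop 18 r) = 1 \<and> weight (drop n r) = 1) (golay_reps k)"
    and n: "16 \<le> n"
  shows "32 * length (golay_reps k) \<le> card (split_heads n)"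
proof -
  let ?R = "set (golay_reps k)"
  define W where "W = {c \<in> golay. card (c \<inter> {16..}) = 0}"
  define g where "g = (\<lambda>(r, w). sym_diff (supp r) w)"
  have "length (filter (\<lambda>w. weight (drop 16 w) = 0) (span_words 24 (drop 7 golay_gens))) = 32"
    by code_simp
  then have W: "32 \<le> card W"
    unfolding W_def by (rule card_golay_Collect_ge) (simp add: card_supp_atLeast)
  have W16: "w \<subseteq> {..<16}" if "w \<in> W" for w
    using that golay_subset_lessThan_iff[of w 16] by (simp add: W_def)
  have g16: "g (r, w) \<inter> {j..} = supp r \<inter> {j..}" if "w \<in> W" "16 \<le> j" for r w j
    using W16[OF that(1)] that(2) by (auto simp: g_def)
  have "inj_on g (?R \<times> W)"
  proof (rule inj_onI, clarify)
    fix r w r' w'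
    assume *: "r \<in> ?R" "w \<in> W" "r' \<in> ?R" "w' \<in> W" "g (r, w) = g (r', w')"
    then have eq: "supp r \<inter> {16..} = supp r' \<inter> {16..}" using g16 by (metis order_refl)
    have "drop 16 r = drop 16 r'"
    proof (rule nth_equalityI)
      show "length (drop 16 r) = length (drop 16 r')" using *(1,3) golay_reps by simp
      fix i assume i: "i < length (drop 16 r)"
      have "16 + i \<in> supp r \<inter> {16..} \<longleftrightarrow> 16 + i \<in> supp r' \<inter> {16..}" by (simp only: eq)
      then show "drop 16 r ! i = drop 16 r' ! i"
        using i *(1,3) golay_reps by (simp add: supp_def)
    qed
    then have "r = r'" using dist *(1,3) by (auto simp: distinct_map dest: inj_onD)
    moreover from this have "w = w'" using *(5) by (simp add: g_def) blast
    ultimately show "r = r' \<and> w = w'" by simp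
  qed
  moreover have "g ` (?R \<times> W) \<subseteq> split_heads n"
  proof clarify
    fix r w assume *: "r \<in> ?R" "w \<in> W"
    have "g (r, w) \<in> golay"
      using * golay_reps golay_sym_diff[of "supp r" w] by (simp add: g_def W_def)
    then show "g (r, w) \<in> split_heads n"
      using * heads n by (auto simp: split_heads_def g16 card_supp_atLeast list_all_iff)
  qed
  moreover have "finite (split_heads n)" using finite_golay by (simp add: split_heads_def)
  ultimately have "card (?R \<times> W) \<le> card (split_heads n)" using card_inj_on_le by blast
  moreover have "card ?R = length (golay_reps k)"
    using dist by (simp add: distinct_card distinct_map)
  ultimately show ?thesis using W by (simp add: card_cartesian_product) (metis le_trans mult.commute mult_le_mono1)
qed

text \<open>Adding \<open>golay_gens ! 6\<close>, whose tail is \<open>{16, 17}\<close>, exchanges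
  16 and 17. This doubles the 6 or 5 generators to 12 or 10 representatives, with 32 words
  each.\<close>

lemma card_split_heads: "384 \<le> card (split_heads 18)" "320 \<le> card (split_heads 19)"
proof -
  have "distinct (map (drop 16) (golay_reps 6))"
    "list_all (\<lambda>r. weight (drop 16 r) = 2 \<and> weight (drop 18 r) = 1 \<and> weight (drop 18 r) = 1) (golay_reps 6)"
    "length (golay_reps 6) = 12"
    by code_simp+
  then show "384 \<le> card (split_heads 18)"
    using card_split_heads_ge[of 6 18] by simp
  have "distinct (map (drop 16) (golay_reps 5))"
    "list_all (\<lambda>r. weight (drop 16 r) = 2 \<and> weight (drop 18 r) = 1 \<and> weight (drop 19 r) = 1) (golay_reps 5)"
    "length (golay_reps 5) = 10"
    by code_simp+
  then show "320 \<le> card (split_heads 19)"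
    using card_split_heads_ge[of 5 19] by simp
qed

lemma card_golay_octads_ge:
  "30 \<le> card {c \<in> golay. card c = 8 \<and> card (c \<inter> {16..}) = 0}"
  "16 \<le> card {c \<in> golay. card c = 8 \<and> card (c \<inter> {18..}) = 0 \<and> card (c \<inter> {16..}) = 2}"
  "48 \<le> card {c \<in> golay. card c = 8 \<and> card (c \<inter> {19..}) = 0 \<and> card (c \<inter> {16..}) = 2}"
  "78 \<le> card {c \<in> golay. card c = 8 \<and> card (c \<inter> {19..}) = 0}"
  "130 \<le> card {c \<in> golay. card c = 8 \<and> card (c \<inter> {20..}) = 0}"
  "210 \<le> card {c \<in> golay. card c = 8 \<and> card (c \<inter> {21..}) = 0}"
  by (rule card_golay_Collect_ge, rule golay_octad_counts, simp add: card_supp_atLeast card_supp)+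

section \<open>The construction applied to the Golay code\<close>

lemma golay_sym_diff_lessThan:
  assumes "c \<in> golay" "d \<in> golay" "c \<noteq> d"
  shows "8 \<le> card (sym_diff c d \<inter> {..<m}) + card (sym_diff c d \<inter> {m..})"
proof -
  have s: "sym_diff c d \<in> golay" using assms by (intro golay_sym_diff)
  then have "finite (sym_diff c d)" using golay_subset finite_subset by blast
  moreover have "sym_diff c d - {..<m} = sym_diff c d \<inter> {m..}" by auto
  ultimately have "card (sym_diff c d) = card (sym_diff c d \<inter> {..<m}) + card (sym_diff c d \<inter> {m..})"
    by (metis card_Int_Diff)
  moreover have "8 \<le> card (sym_diff c d)" using s assms(3) by (intro golay_min_card) auto
  ultimately show ?thesis by simp
qed

text \<open>The case \<open>T = {}\<close>, \<open>m = n\<close> with \<open>\<phi>\<close> the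
  identity, for dimensions 19 to 21.\<close>

lemma kissing_number_ge_golay_section:
  fixes D :: "nat set set"
  assumes n: "n = DIM('a::euclidean_space)" "18 \<le> n"
    and D: "D \<subseteq> golay"
      "\<And>c d. c \<in> D \<Longrightarrow> d \<in> D \<Longrightarrow> c \<noteq> d \<Longrightarrow> n \<le> 4 * card (sym_diff c d \<inter> {..<n})"
  shows "4 * (n choose 2) + 128 * card {c \<in> golay. card c = 8 \<and> card (c \<inter> {n..}) = 0} + card D
    \<le> kissing_number TYPE('a)"
proof -
  have fin: "finite D" using D(1) finite_golay finite_subset by blast
  have "card (signed_pairs n {}) + card (signed_octads golay n n {}) + card D \<le> kissing_number TYPE('a)"
    using n D fin
    by (intro card_sum_construction_le_kissing_number[where \<phi> = "\<lambda>x. x"]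
        golay_sym_diff golay_min_card golay_even_Int) (auto simp: balanced_def)
  moreover have "4 * (n choose 2) \<le> card (signed_pairs n {})"
    using card_signed_pairs_ge[of "{}" n] by simp
  moreover have "{c \<in> golay. c \<subseteq> {..<n} \<and> card c = 8} = {c \<in> golay. card c = 8 \<and> card (c \<inter> {n..}) = 0}"
    using golay_subset_lessThan_iff by blast
  then have "128 * card {c \<in> golay. card c = 8 \<and> card (c \<inter> {n..}) = 0} \<le> card (signed_octads golay n n {})"
    using card_signed_octads_ge[of n "{}" n golay] by simp
  ultimately show ?thesis by linarith
qed

text \<open>The case \<open>m = 18\<close>, \<open>T = {16..<n}\<close>, for dimension
  \<open>n - 1\<close>. Here \<open>480 = 4 * (16 choose 2)\<close> counts signed pairs outside
  \<open>T\<close>, and the next product those inside it.\<close>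

lemma kissing_number_ge_golay_balanced_section:
  fixes \<phi> :: "(nat \<Rightarrow> real) \<Rightarrow> nat \<Rightarrow> real"
  assumes n: "n = 18 \<or> n = 19"
    and \<phi>: "\<And>x y. (\<Sum>i=16..<n. x i) = 0 \<Longrightarrow> (\<Sum>i=16..<n. y i) = 0 \<Longrightarrow>
      (\<Sum>i<DIM('a). \<phi> x i * \<phi> y i) = (\<Sum>i<n. x i * y i)"
  shows "480 + (n - 16) * (n - 17) + 128 * 30
      + 64 * card {c \<in> golay. card c = 8 \<and> card (c \<inter> {n..}) = 0 \<and> card (c \<inter> {16..}) = 2}
      + card (split_heads n) \<le> kissing_number TYPE('a::euclidean_space)"
proof -
  let ?T = "{16..<n}" and ?D = "split_heads n"
  have fin: "finite c" if "c \<in> golay" for c using golay_subset[OF that] finite_subset by blast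
  have split: "card (c \<inter> {j..}) = card (c \<inter> {j..<k}) + card (c \<inter> {k..})" if "c \<in> golay" "j \<le> k" for c j k
  proof -
    have "c \<inter> {j..} = (c \<inter> {j..<k}) \<union> (c \<inter> {k..})" using that(2) by auto
    then show ?thesis using fin[OF that(1)] by (simp add: card_Un_disjoint disjoint_iff)
  qed
  have D: "c \<in> golay" "card (c \<inter> {16..<18}) = 1" "c \<inter> {18..<n} = {}" "card (c \<inter> {18..}) = 1"
    if "c \<in> ?D" for c
  proof -
    show c: "c \<in> golay" and "card (c \<inter> {18..}) = 1" using that by (auto simp: split_heads_def)
    show "card (c \<inter> {16..<18}) = 1" using that split[OF c, of 16 18] by (simp add: split_heads_def)
    have "18 \<le> n" "card (c \<inter> {18..}) = card (c \<inter> {n..})" using that n by (auto simp: split_heads_def)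
    then have "card (c \<inter> {18..<n}) = 0" using split[OF c, of 18 n] by linarith
    then show "c \<inter> {18..<n} = {}" using fin[OF c] by simp
  qed
  have "card (signed_pairs n ?T) + card (signed_octads golay 18 n ?T) + card ?D \<le> kissing_number TYPE('a)"
  proof (rule card_sum_construction_le_kissing_number[where \<phi> = \<phi>])
    show "?D \<subseteq> golay" "finite ?D" using finite_golay by (auto simp: split_heads_def)
    fix c assume c: "c \<in> ?D"
    show "c \<inter> {..<n} \<subseteq> {..<18}" using D(3)[OF c] by (auto simp: not_le disjoint_iff)
    have "{..<18} \<inter> ?T = {16..<18}" "c \<inter> {..<18} \<inter> ?T = c \<inter> {16..<18}" using n by auto
    then show "balanced ?T {..<18} (c \<inter> {..<18})" using D(2)[OF c] by (simp add: balanced_def)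
    fix d assume d: "d \<in> ?D" "c \<noteq> d"
    \<comment> \<open>Each word of \<open>D\<close> has a single point from 18 on, so two of them
      differ there in at most 2 places. At least 6 differences remain below 18.\<close>
    have "card (sym_diff c d \<inter> {18..}) \<le> card ((c \<inter> {18..}) \<union> (d \<inter> {18..}))"
      using fin D(1)[OF c] D(1)[OF d(1)] by (intro card_mono) auto
    also have "\<dots> \<le> 2" using D(4)[OF c] D(4)[OF d(1)] card_Un_le[of "c \<inter> {18..}" "d \<inter> {18..}"] by simp
    finally show "18 \<le> 4 * card (sym_diff c d \<inter> {..<18})"
      using golay_sym_diff_lessThan[OF D(1)[OF c] D(1)[OF d(1)] d(2), of 18] by simp
  qed (use n \<phi> in \<open>auto intro: golay_sym_diff golay_min_card golay_even_Int\<close>)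
  moreover have "480 + (n - 16) * (n - 17) \<le> card (signed_pairs n ?T)"
  proof -
    have "{..<n} - ?T = {..<16}" using n by auto
    moreover have "(16::nat) choose 2 = 120" by (simp add: choose_two)
    moreover have "?T \<subseteq> {..<n}" by auto
    ultimately show ?thesis using card_signed_pairs_ge[of ?T n] by simp
  qed
  moreover have "128 * 30 + 64 * card {c \<in> golay. card c = 8 \<and> card (c \<inter> {n..}) = 0 \<and> card (c \<inter> {16..}) = 2}
      \<le> card (signed_octads golay 18 n ?T)"
  proof -
    have *: "c \<subseteq> {..<n} \<and> c \<inter> ?T = {} \<longleftrightarrow> card (c \<inter> {16..}) = 0" if "c \<in> golay" for c
    proof -
      have "card (c \<inter> {16..}) = 0 \<longleftrightarrow> c \<subseteq> {..<16}" using golay_subset_lessThan_iff[OF that] by simp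
      also have "\<dots> \<longleftrightarrow> c \<subseteq> {..<n} \<and> c \<inter> ?T = {}" using n by (fastforce simp: not_le)
      finally show ?thesis by simp
    qed
    have **: "c \<subseteq> {..<n} \<and> card (c \<inter> ?T) = 2 \<longleftrightarrow> card (c \<inter> {n..}) = 0 \<and> card (c \<inter> {16..}) = 2"
      if "c \<in> golay" for c
      using golay_subset_lessThan_iff[OF that, of n] split[OF that, of 16 n] n by auto
    have "{c \<in> golay. c \<subseteq> {..<n} \<and> card c = 8 \<and> c \<inter> ?T = {}} = {c \<in> golay. card c = 8 \<and> card (c \<inter> {16..}) = 0}"
      "{c \<in> golay. c \<subseteq> {..<n} \<and> card c = 8 \<and> card (c \<inter> ?T) = 2}
        = {c \<in> golay. card c = 8 \<and> card (c \<inter> {n..}) = 0 \<and> card (c \<inter> {16..}) = 2}"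
      using * ** by blast+
    moreover have "{..<n} - ?T \<subseteq> {..<18}" by auto
    ultimately show ?thesis
      using card_signed_octads_ge[of n ?T 18 golay] card_golay_octads_ge(1) by simp
  qed
  ultimately show ?thesis by linarith
qed

text \<open>
  In the next two lemmas \<open>\<phi>\<close> reads off coordinates with respect to an orthonormal basis of the
  hyperplane on which the coordinates from 16 on sum to zero.
\<close>

lemma kissing_number_17: "5730 \<le> kissing_number TYPE(real ^ 17)"
proof -
  define \<phi> where "\<phi> x i = (if i < 16 then x i else sqrt 2 * x 16)" for x :: "nat \<Rightarrow> real" and i :: nat
  have "(\<Sum>i<17. \<phi> x i * \<phi> y i) = (\<Sum>i<18. x i * y i)"
    if "(\<Sum>i=16..<18. x i) = 0" "(\<Sum>i=16..<18. y i) = 0" for x y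
  proof -
    have s: "{..<17::nat} = insert 16 {..<16}" "{..<18::nat} = insert 16 (insert 17 {..<16})"
      "{16..<18::nat} = {16, 17}" by auto
    have "x 17 = - x 16" "y 17 = - y 16" using that unfolding s by simp_all
    then show ?thesis unfolding s by (simp add: \<phi>_def)
  qed
  \<comment> \<open>The total is \<open>480 + 2 + 3840 + 64 * 16 + 384 = 5730\<close>.\<close>
  then show ?thesis
    using kissing_number_ge_golay_balanced_section[where 'a = "real ^ 17" and n = 18 and \<phi> = \<phi>]
      card_golay_octads_ge(2) card_split_heads(1) by simp
qed

lemma kissing_number_18: "7718 \<le> kissing_number TYPE(real ^ 18)"
proof -
  \<comment> \<open>The last two coordinates are inner products with
    \<open>(1, -1, 0) / sqrt 2\<close> and \<open>(1, 1, -2) / sqrt 6\<close>, after eliminating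
    \<open>x 18\<close>.\<close>
  define \<phi> where "\<phi> x i = (if i < 16 then x i
    else if i = 16 then (x 16 - x 17) / sqrt 2 else (x 16 + x 17) * sqrt (3 / 2))"
    for x :: "nat \<Rightarrow> real" and i :: nat
  have "(\<Sum>i<18. \<phi> x i * \<phi> y i) = (\<Sum>i<19. x i * y i)"
    if "(\<Sum>i=16..<19. x i) = 0" "(\<Sum>i=16..<19. y i) = 0" for x y
  proof -
    have s: "{..<18::nat} = insert 16 (insert 17 {..<16})"
      "{..<19::nat} = insert 16 (insert 17 (insert 18 {..<16}))"
      "{16..<19::nat} = {16, 17, 18}" by auto
    have 18: "x 18 = - x 16 - x 17" "y 18 = - y 16 - y 17" using that unfolding s by simp_all
    have 16: "\<phi> x 16 * \<phi> y 16 = (x 16 - x 17) * (y 16 - y 17) / 2"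
      by (simp add: \<phi>_def)
    have "\<phi> x 17 * \<phi> y 17 = (x 16 + x 17) * (y 16 + y 17) * (sqrt (3 / 2) * sqrt (3 / 2))"
      unfolding \<phi>_def by (simp del: real_sqrt_mult_self)
    then have 17: "\<phi> x 17 * \<phi> y 17 = (x 16 + x 17) * (y 16 + y 17) * (3 / 2)"
      by (simp only: real_sqrt_mult_self)
    have "(\<Sum>i<16. \<phi> x i * \<phi> y i) = (\<Sum>i<16. x i * y i)"
      by (simp add: \<phi>_def)
    then show ?thesis unfolding s by (simp add: 16 17 18 field_simps)
  qed
  \<comment> \<open>The total is \<open>480 + 6 + 3840 + 64 * 48 + 320 = 7718\<close>, more than the
    7654 finally claimed.\<close>
  then show ?thesis
    using kissing_number_ge_golay_balanced_section[where 'a = "real ^ 18" and n = 19 and \<phi> = \<phi>]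
      card_golay_octads_ge(3) card_split_heads(2) by simp
qed

section \<open>Parity subcodes and dimensions 19 to 21\<close>

definition even_golay :: "nat set \<Rightarrow> nat set set" where
  "even_golay A = {c \<in> golay. even (card (c \<inter> A))}"

lemma even_golay_sym_diff:
  assumes "c \<in> even_golay A" "d \<in> even_golay A"
  shows "sym_diff c d \<in> even_golay A"
proof -
  have "finite c" "finite d" using assms golay_subset by (auto simp: even_golay_def intro: finite_subset)
  moreover have "sym_diff c d \<inter> A = sym_diff (c \<inter> A) (d \<inter> A)" by blast
  ultimately show ?thesis
    using assms golay_sym_diff[of c d] by (simp add: even_golay_def even_card_sym_diff)
qed

lemma card_even_golay: "2048 \<le> card (even_golay A)"
  using card_linear_code_even_ge[OF length_golay_gens, of golay A] golay_sym_diff card_golay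
  by (simp add: even_golay_def golay_def)

lemma card_even_golay_Int: "1024 \<le> card (even_golay A \<inter> even_golay B)"
proof -
  have "card (even_golay A) \<le> 2 * card {c \<in> even_golay A. even (card (c \<inter> B))}"
  proof (rule card_linear_code_even_ge[OF length_golay_gens])
    show "even_golay A \<subseteq> linear_code 24 golay_gens" by (auto simp: even_golay_def golay_def)
  qed (rule even_golay_sym_diff)
  moreover have "{c \<in> even_golay A. even (card (c \<inter> B))} = even_golay A \<inter> even_golay B"
    by (auto simp: even_golay_def)
  ultimately show ?thesis using card_even_golay[of A] by simp
qed

lemma golay_sym_diff_lessThan_ge:
  assumes "c \<in> golay" "d \<in> golay" "c \<noteq> d" "sym_diff c d \<inter> {m..} \<subseteq> A" "finite A"
  shows "8 \<le> card (sym_diff c d \<inter> {..<m}) + card A"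
  using golay_sym_diff_lessThan[OF assms(1-3), of m] card_mono[OF assms(5,4)] by linarith

text \<open>Evenness on a singleton means avoiding that point. Words avoiding 22 and 23 lose at most
  3 of their distance 8 on deletion, and \<open>19 \<le> 4 * 5\<close>. The total is
  \<open>684 + 128 * 78 + 1024\<close>.\<close>

lemma kissing_number_19: "11692 \<le> kissing_number TYPE(real ^ 19)"
proof -
  let ?D = "even_golay {22} \<inter> even_golay {23}"
  have "19 \<le> 4 * card (sym_diff c d \<inter> {..<19})" if "c \<in> ?D" "d \<in> ?D" "c \<noteq> d" for c d
  proof -
    have cd: "c \<in> golay" "d \<in> golay" using that by (auto simp: even_golay_def)
    have "22 \<notin> c" "23 \<notin> c" "22 \<notin> d" "23 \<notin> d"
      using that by (auto simp: even_golay_def Int_insert_right split: if_splits)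
    then have "i \<in> {19, 20, 21}" if "i \<in> sym_diff c d \<inter> {19..}" for i
    proof -
      have "i < 24" "i \<noteq> 22" "i \<noteq> 23" using that cd golay_subset \<open>22 \<notin> c\<close> \<open>23 \<notin> c\<close> \<open>22 \<notin> d\<close> \<open>23 \<notin> d\<close> by auto
      then show ?thesis using that by auto
    qed
    then have "sym_diff c d \<inter> {19..} \<subseteq> {19, 20, 21}" by blast
    then have "8 \<le> card (sym_diff c d \<inter> {..<19}) + card {19, 20, 21::nat}"
      by (rule golay_sym_diff_lessThan_ge[OF cd that(3)]) simp
    then show ?thesis by simp
  qed
  then have "4 * (19 choose 2) + 128 * card {c \<in> golay. card c = 8 \<and> card (c \<inter> {19..}) = 0} + card ?D
      \<le> kissing_number TYPE(real ^ 19)"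
    by (intro kissing_number_ge_golay_section) (auto simp: even_golay_def)
  moreover have "(19::nat) choose 2 = 171" by (simp add: choose_two)
  ultimately show ?thesis using card_golay_octads_ge(4) card_even_golay_Int[of "{22}" "{23}"] by simp
qed

text \<open>Avoiding 23 alone leaves three deleted places and distance 5, which is just enough:
  \<open>20 = 4 * 5\<close>. The total is \<open>760 + 128 * 130 + 2048\<close>.\<close>

lemma kissing_number_20: "19448 \<le> kissing_number TYPE(real ^ 20)"
proof -
  let ?D = "even_golay {23}"
  have "20 \<le> 4 * card (sym_diff c d \<inter> {..<20})" if "c \<in> ?D" "d \<in> ?D" "c \<noteq> d" for c d
  proof -
    have cd: "c \<in> golay" "d \<in> golay" using that by (auto simp: even_golay_def)
    have "23 \<notin> c" "23 \<notin> d"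
      using that by (auto simp: even_golay_def Int_insert_right split: if_splits)
    have "i \<in> {20, 21, 22}" if "i \<in> sym_diff c d \<inter> {20..}" for i
    proof -
      have "i < 24" "i \<noteq> 23" using that cd golay_subset \<open>23 \<notin> c\<close> \<open>23 \<notin> d\<close> by auto
      then show ?thesis using that by auto
    qed
    then have "sym_diff c d \<inter> {20..} \<subseteq> {20, 21, 22}" by blast
    then have "8 \<le> card (sym_diff c d \<inter> {..<20}) + card {20, 21, 22::nat}"
      by (rule golay_sym_diff_lessThan_ge[OF cd that(3)]) simp
    then show ?thesis by simp
  qed
  then have "4 * (20 choose 2) + 128 * card {c \<in> golay. card c = 8 \<and> card (c \<inter> {20..}) = 0} + card ?D
      \<le> kissing_number TYPE(real ^ 20)"
    by (intro kissing_number_ge_golay_section) (auto simp: even_golay_def)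
  moreover have "(20::nat) choose 2 = 190" by (simp add: choose_two)
  ultimately show ?thesis using card_golay_octads_ge(5) card_even_golay[of "{23}"] by simp
qed

text \<open>Distance 6 is now required. Evenness on the three deleted coordinates makes the number
  of differences there even, hence at most 2. The total is
  \<open>840 + 128 * 210 + 2048\<close>.\<close>

lemma kissing_number_21: "29768 \<le> kissing_number TYPE(real ^ 21)"
proof -
  let ?D = "even_golay {21, 22, 23}"
  have "21 \<le> 4 * card (sym_diff c d \<inter> {..<21})" if "c \<in> ?D" "d \<in> ?D" "c \<noteq> d" for c d
  proof -
    have cd: "c \<in> golay" "d \<in> golay" using that by (auto simp: even_golay_def)
    let ?X = "sym_diff c d \<inter> {21..}"
    have "i \<in> {21, 22, 23}" if "i \<in> ?X" for i
    proof -
      have "i < 24" using that cd golay_subset by auto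
      then show ?thesis using that by auto
    qed
    then have X: "?X \<subseteq> {21, 22, 23}" by blast
    then have "?X = sym_diff c d \<inter> {21, 22, 23}" by auto
    then have "even (card ?X)"
      using even_golay_sym_diff[OF that(1,2)] by (simp add: even_golay_def)
    moreover have "card ?X \<le> 3" using card_mono[OF _ X] by simp
    ultimately have "card ?X \<le> 2" by (cases "card ?X = 3") auto
    then show ?thesis using golay_sym_diff_lessThan[OF cd that(3), of 21] by simp
  qed
  then have "4 * (21 choose 2) + 128 * card {c \<in> golay. card c = 8 \<and> card (c \<inter> {21..}) = 0} + card ?D
      \<le> kissing_number TYPE(real ^ 21)"
    by (intro kissing_number_ge_golay_section) (auto simp: even_golay_def)
  moreover have "(21::nat) choose 2 = 210" by (simp add: choose_two)
  ultimately show ?thesis using card_golay_octads_ge(6) card_even_golay[of "{21, 22, 23}"] by simp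
qed

theorem theorem1p1:
  shows "kissing_number TYPE(real ^ 17) \<ge> 5730 \<and>
         kissing_number TYPE(real ^ 18) \<ge> 7654 \<and>
         kissing_number TYPE(real ^ 19) \<ge> 11692 \<and>
         kissing_number TYPE(real ^ 20) \<ge> 19448 \<and>
         kissing_number TYPE(real ^ 21) \<ge> 29768"
  using kissing_number_17 kissing_number_18 kissing_number_19 kissing_number_20 kissing_number_21
  by simp

end
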